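(* For all $m,n\ge 1$, the polytope $SATP_{LP}(m,n)$ has the Trubin-property with respect to $SATP(m,n)$, i.e. the $1$-skeleton of $SATP(m,n)$ is a subset of the $1$-skeleton of $SATP_{LP}(m,n)$.
   Context: For positive integers $m,n$, points of $\mathbb{R}^{6mn}$ have coordinates $x^{k,l}_{i,j}$ with $k\in\{1,2,3\}$, $l\in\{1,2\}$, $i\in\{1,\dots,m\}$, $j\in\{1,\dots,n\}$. $SATP_{LP}(m,n)\subset\mathbb{R}^{6mn}$ is the polytope of all solutions of the system $$\sum_{k,l}x^{k,l}_{i,j}=1,\qquad x^{1,1}_{i,j}+x^{2,1}_{i,j}+x^{3,1}_{i,j}=x^{1,1}_{i,t}+x^{2,1}_{i,t}+x^{3,1}_{i,t},\qquad x^{k,1}_{i,j}+x^{k,2}_{i,j}=x^{k,1}_{s,j}+x^{k,2}_{s,j},\qquad x^{k,l}_{i,j}\ge 0,$$ for all $k\in\{1,2,3\}$, $l\in\{1,2\}$, $i,s\in\{1,\dots,m\}$, $j,t\in\{1,\dots,n\}$, and $SATP(m,n)$ is the convex hull of all integral solutions of this system. The 1-skeleton of a polytope $P$ is the collection of its vertices ($0$-faces) and its edges ($1$-faces). If $Q\subseteq P$ are polytopes, $P$ has the Trubin-property with respect to $Q$ if the 1-skeleton of $Q$ is a subset of the 1-skeleton of $P$ (every vertex of $Q$ is a vertex of $P$ and every edge of $Q$ is an edge of $P$). *)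

theory Defs
  imports "HOL-Analysis.Analysis"
begin

text \<open>
  The coordinate written \<open>x\<^sup>k\<^sup>,\<^sup>l\<close> with lower indices \<open>i, j\<close> is \<open>x $ (k, l, i, j)\<close>. The index
  sets \<open>{1..m}\<close> and \<open>{1..n}\<close> are finite (hence nonempty) types \<open>'m\<close> and \<open>'n\<close>, and
  \<open>k \<in> {1,2,3}\<close>, \<open>l \<in> {1,2}\<close> range over the numeral types \<open>3\<close> and \<open>2\<close>: there \<open>3 = 0\<close>,
  respectively \<open>2 = 0\<close>, so \<open>1, 2, 3\<close> and \<open>1, 2\<close> enumerate exactly their elements.
\<close>

type_synonym ('m, 'n) satp_space = "real ^ (3 \<times> 2 \<times> 'm \<times> 'n)"

definition satp_lp :: "('m::finite, 'n::finite) satp_space set" where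
  "satp_lp = {x.
     (\<forall>i j. (\<Sum>k\<in>UNIV. \<Sum>l\<in>UNIV. x $ (k, l, i, j)) = 1) \<and>
     (\<forall>i j t. x $ (1, 1, i, j) + x $ (2, 1, i, j) + x $ (3, 1, i, j)
            = x $ (1, 1, i, t) + x $ (2, 1, i, t) + x $ (3, 1, i, t)) \<and>
     (\<forall>k i s j. x $ (k, 1, i, j) + x $ (k, 2, i, j)
              = x $ (k, 1, s, j) + x $ (k, 2, s, j)) \<and>
     (\<forall>k l i j. x $ (k, l, i, j) \<ge> 0)}"

definition satp :: "('m::finite, 'n::finite) satp_space set" where
  "satp = convex hull {x \<in> satp_lp. \<forall>k l i j. x $ (k, l, i, j) \<in> \<int>}"

definition one_skeleton :: "'a::euclidean_space set \<Rightarrow> 'a set set" where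
  "one_skeleton P = {F. F face_of P \<and> aff_dim F = 0} \<union> {F. F edge_of P}"

text \<open>
  The Trubin-property is only meaningful for polytopes \<open>Q \<subseteq> P\<close>, so these requirements are part
  of the predicate. A member of \<open>one_skeleton Q\<close> of dimension 0 (or 1) can only be a member of
  \<open>one_skeleton P\<close> of the same dimension, so the inclusion says that vertices are vertices and
  edges are edges.
\<close>

definition trubin_property :: "'a::euclidean_space set \<Rightarrow> 'a set \<Rightarrow> bool" where
  "trubin_property P Q \<longleftrightarrow>
     polytope P \<and> polytope Q \<and> Q \<subseteq> P \<and> one_skeleton Q \<subseteq> one_skeleton P"

end

theory Submission
  imports Defs
begin

text \<open>An integral solution chooses a label \<open>k j\<close> for every column and
  \<open>l i\<close> for every row, and puts the unit of cell (i, j) on the entry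
  (\<open>k j\<close>, \<open>l i\<close>) (\<open>integral_satp_lp_eq\<close>). Hence a vertex or
  edge of \<open>satp\<close> is a possibly degenerate segment [u, v] between two such points
  (\<open>face_of_satp_low_dim\<close>), and it remains to see that such a segment is a face of
  \<open>satp_lp\<close> (\<open>segment_face_of_satp_lp\<close>).

  Let F be the face of \<open>satp_lp\<close> cut out by the vanishing of all coordinates that are
  zero at both u and v (\<open>face_of_satp_lp_zero\<close>). It contains [u, v]. A point of F
  splits the unit of each cell where u and v differ into 1 - t on the entry of u and t on that of v,
  and the marginal equations make t constant along every changing column and every changing row. If
  there are both, these lines cross and t is one global number. If only columns or only rows change,
  at most one does: otherwise swapping a single label between u and v would give another pair of
  integral points with the same midpoint, which a face of \<open>satp\<close> excludes
  (\<open>satp_point_exchange\<close>). So t is global in every case, and the point is (1 - t) u + t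
  v.\<close>

lemma satp_lp_sum_cell:
  "x \<in> satp_lp \<Longrightarrow> (\<Sum>k\<in>UNIV. \<Sum>l\<in>UNIV. x $ (k, l, i, j)) = 1"
  by (simp add: satp_lp_def)

lemma satp_lp_nonneg: "x \<in> satp_lp \<Longrightarrow> x $ e \<ge> 0"
  by (cases e) (simp add: satp_lp_def)

text \<open>The system states this for \<open>l = 1\<close> only; since each cell has total 1, the
  case \<open>l = 2\<close> is the complement.\<close>

lemma satp_lp_row:
  assumes "x \<in> satp_lp"
  shows "(\<Sum>k\<in>UNIV. x $ (k, l, i, j)) = (\<Sum>k\<in>UNIV. x $ (k, l, i, t))"
proof -
  have 1: "x $ (1, 1, i, j) + x $ (2, 1, i, j) + x $ (3, 1, i, j)
            = x $ (1, 1, i, t) + x $ (2, 1, i, t) + x $ (3, 1, i, t)"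
    using assms unfolding satp_lp_def by blast
  have 2: "x $ (1, 2, i, j) + x $ (2, 2, i, j) + x $ (3, 2, i, j)
            = x $ (1, 2, i, t) + x $ (2, 2, i, t) + x $ (3, 2, i, t)"
    using 1 satp_lp_sum_cell[OF assms, of i j] satp_lp_sum_cell[OF assms, of i t]
    unfolding sum_2 sum_3 by linarith
  show ?thesis
    using exhaust_2[of l] 1 2 unfolding sum_3 by auto
qed

lemma satp_lp_column:
  "x \<in> satp_lp \<Longrightarrow> (\<Sum>l\<in>UNIV. x $ (k, l, i, j)) = (\<Sum>l\<in>UNIV. x $ (k, l, s, j))"
  unfolding satp_lp_def sum_2 by blast

lemma satp_lp_le_1:
  assumes "x \<in> satp_lp"
  shows "x $ e \<le> 1"
proof -
  obtain k l i j where e: "e = (k, l, i, j)" by (cases e)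
  have "x $ (k, l, i, j) \<le> (\<Sum>l\<in>UNIV. x $ (k, l, i, j))"
    using assms by (intro member_le_sum) (auto intro: satp_lp_nonneg)
  also have "\<dots> \<le> (\<Sum>k\<in>UNIV. \<Sum>l\<in>UNIV. x $ (k, l, i, j))"
    using assms by (intro member_le_sum[of k UNIV "\<lambda>k. \<Sum>l\<in>UNIV. x $ (k, l, i, j)"])
      (auto intro: satp_lp_nonneg sum_nonneg)
  finally show ?thesis using satp_lp_sum_cell[OF assms] e by simp
qed

section \<open>The relaxation is a polytope\<close>

text \<open>A linear functional is the inner product with a fixed vector, the image of 1 under its
  adjoint.\<close>

lemma polyhedron_linear_le:
  fixes f :: "'a::euclidean_space \<Rightarrow> real"
  assumes "linear f"
  shows "polyhedron {x. f x \<le> c}"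
proof -
  have "f x = adjoint f 1 \<bullet> x" for x
    using adjoint_works[OF assms, of x 1] by (simp add: inner_commute)
  then show ?thesis by (simp add: polyhedron_halfspace_le)
qed

lemma polyhedron_linear_eq:
  fixes f g :: "'a::euclidean_space \<Rightarrow> real"
  assumes "linear f" "linear g"
  shows "polyhedron {x. f x = g x + c}"
proof -
  have "{x. f x = g x + c} = {x. f x - g x \<le> c} \<inter> {x. g x - f x \<le> - c}" by auto
  then show ?thesis
    by (simp add: assms polyhedron_Int polyhedron_linear_le linear_compose_sub)
qed

lemma polyhedron_INT_finite:
  fixes S :: "'i::finite \<Rightarrow> 'a::euclidean_space set"
  shows "(\<And>i. polyhedron (S i)) \<Longrightarrow> polyhedron (\<Inter>i. S i)"
  by (auto intro: polyhedron_Inter)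

lemma linear_vec_nth: "linear (\<lambda>x::real^'n. x $ e)"
  by (rule bounded_linear.linear) (rule bounded_linear_vec_nth)

lemma polytope_satp_lp: "polytope (satp_lp :: ('m::finite, 'n::finite) satp_space set)"
proof -
  \<comment> \<open>The summands 0 bring each equation into the form \<open>f x = g x + c\<close> of
    \<open>polyhedron_linear_eq\<close>.\<close>
  let ?A = "\<lambda>(i::'m, j::'n). {x :: ('m, 'n) satp_space.
      (\<Sum>k\<in>UNIV. \<Sum>l\<in>UNIV. x $ (k, l, i, j)) = 0 + 1}"
  let ?B = "\<lambda>(i::'m, j::'n, t). {x :: ('m, 'n) satp_space.
      x $ (1, 1, i, j) + x $ (2, 1, i, j) + x $ (3, 1, i, j)
            = (x $ (1, 1, i, t) + x $ (2, 1, i, t) + x $ (3, 1, i, t)) + 0}"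
  let ?C = "\<lambda>(k, i::'m, s, j::'n). {x :: ('m, 'n) satp_space.
      x $ (k, 1, i, j) + x $ (k, 2, i, j) = (x $ (k, 1, s, j) + x $ (k, 2, s, j)) + 0}"
  let ?D = "\<lambda>e. {x :: ('m, 'n) satp_space. - (x $ e) \<le> 0}"
  have eq: "satp_lp = (\<Inter>e. ?A e) \<inter> (\<Inter>e. ?B e) \<inter> (\<Inter>e. ?C e) \<inter> (\<Inter>e. ?D e)"
    unfolding satp_lp_def by (auto simp: split_paired_all)
  have "polyhedron (satp_lp :: ('m, 'n) satp_space set)"
    unfolding eq
    by (intro polyhedron_Int polyhedron_INT_finite)
      (auto simp only: split_paired_all case_prod_conv
        intro!: polyhedron_linear_eq polyhedron_linear_le linear_compose_add
          linear_compose_sum linear_vec_nth linear_compose_neg linear_zero)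
  moreover have "satp_lp \<subseteq> cbox (0 :: ('m, 'n) satp_space) 1"
    by (auto simp: mem_box_cart satp_lp_nonneg satp_lp_le_1)
  then have "bounded (satp_lp :: ('m, 'n) satp_space set)"
    using bounded_cbox bounded_subset by blast
  ultimately show ?thesis by (simp add: polytope_eq_bounded_polyhedron)
qed

lemma convex_satp_lp: "convex satp_lp"
  using polytope_satp_lp by (rule polytope_imp_convex)

section \<open>Integral points as labellings of columns and rows\<close>

definition satp_point :: "('n \<Rightarrow> 3) \<Rightarrow> ('m \<Rightarrow> 2) \<Rightarrow> ('m::finite, 'n::finite) satp_space" where
  "satp_point k l = vec_lambda (\<lambda>(a, b, i, j). of_bool (a = k j \<and> b = l i))"

lemma satp_point_nth [simp]:
  "satp_point k l $ (a, b, i, j) = of_bool (a = k j \<and> b = l i)"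
  by (simp add: satp_point_def)

lemma satp_point_eq_iff [simp]:
  fixes k :: "'n::finite \<Rightarrow> 3" and l :: "'m::finite \<Rightarrow> 2"
  shows "satp_point k l = satp_point k' l' \<longleftrightarrow> k = k' \<and> l = l'"
proof
  assume eq: "satp_point k l = satp_point k' l'"
  have "k j = k' j \<and> l i = l' i" for i j
    using arg_cong[OF eq, of "\<lambda>x. x $ (k j, l i, i, j)"] by simp
  then show "k = k' \<and> l = l'" by auto
qed simp

lemma satp_point_in_satp_lp: "satp_point k l \<in> satp_lp"
proof -
  have "(\<Sum>a\<in>UNIV. \<Sum>b\<in>UNIV. satp_point k l $ (a, b, i, j)) = 1" for i j
  proof -
    have "(\<Sum>a\<in>UNIV. \<Sum>b\<in>UNIV. satp_point k l $ (a, b, i, j))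
        = (\<Sum>a\<in>UNIV. \<Sum>b\<in>UNIV. if b = l i then of_bool (a = k j) else 0)"
      by (intro sum.cong) auto
    also have "\<dots> = 1" by simp
    finally show ?thesis .
  qed
  moreover have "satp_point k l $ (1, 1, i, j) + satp_point k l $ (2, 1, i, j)
      + satp_point k l $ (3, 1, i, j) = of_bool (l i = 1)" for i j
    using exhaust_3[of "k j"] by auto
  moreover have "satp_point k l $ (a, 1, i, j) + satp_point k l $ (a, 2, i, j)
      = of_bool (a = k j)" for a i j
    using exhaust_2[of "l i"] by auto
  ultimately show ?thesis unfolding satp_lp_def by (simp del: satp_point_nth) simp
qed

text \<open>A nonzero nonnegative integer is at least 1, so a single value already exhausts the
  sum.\<close>

lemma integral_sum_eq_1_imp_indicator:
  fixes f :: "'a::finite \<Rightarrow> real"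
  assumes int: "\<And>a. f a \<in> \<int>" and nonneg: "\<And>a. f a \<ge> 0" and sum: "sum f UNIV = 1"
  shows "\<exists>a. \<forall>b. f b = of_bool (b = a)"
proof -
  obtain a where a: "f a \<noteq> 0"
    using sum by (metis sum.neutral zero_neq_one)
  then have "f a \<ge> 1"
    using int[of a] nonneg[of a] by (auto elim!: Ints_cases)
  moreover have "sum f UNIV = f a + sum f (UNIV - {a})"
    by (simp add: sum.remove)
  moreover have "sum f (UNIV - {a}) \<ge> 0"
    using nonneg by (simp add: sum_nonneg)
  ultimately have "f a = 1" "sum f (UNIV - {a}) = 0"
    using sum by linarith+
  moreover from this(2) have "\<forall>b \<in> UNIV - {a}. f b = 0"
    using nonneg by (subst (asm) sum_nonneg_eq_0_iff) auto
  ultimately show ?thesis by (intro exI[of _ a]) auto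
qed

text \<open>The column marginals \<open>Z\<close> and row marginals \<open>Y\<close> of an integral
  solution are integral distributions, hence indicators of one label each. Every entry is bounded by
  both of its marginals, so in a cell only the entry carrying both labels survives.\<close>

lemma integral_satp_lp_eq:
  "{x \<in> satp_lp. \<forall>k l i j. x $ (k, l, i, j) \<in> \<int>} = range (case_prod satp_point)"
proof (intro equalityI subsetI)
  fix x :: "('a::finite, 'b::finite) satp_space"
  assume "x \<in> {x \<in> satp_lp. \<forall>k l i j. x $ (k, l, i, j) \<in> \<int>}"
  then have x: "x \<in> satp_lp" and int: "x $ (k, l, i, j) \<in> \<int>" for k l i j by auto
  \<comment> \<open>Here \<open>undefined\<close> is just a reference row or column; the next two
    facts show that its choice is immaterial.\<close>
  define Z where "Z k j = (\<Sum>l\<in>UNIV. x $ (k, l, undefined, j))" for k j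
  define Y where "Y l i = (\<Sum>k\<in>UNIV. x $ (k, l, i, undefined))" for l i
  have Z: "Z k j = (\<Sum>l\<in>UNIV. x $ (k, l, i, j))" for k i j
    unfolding Z_def by (rule satp_lp_column[OF x])
  have Y: "Y l i = (\<Sum>k\<in>UNIV. x $ (k, l, i, j))" for l i j
    unfolding Y_def by (rule satp_lp_row[OF x])
  have "\<exists>a. \<forall>k. Z k j = of_bool (k = a)" for j
    by (rule integral_sum_eq_1_imp_indicator)
      (auto simp: Z_def satp_lp_sum_cell[OF x] intro!: int Ints_sum sum_nonneg satp_lp_nonneg[OF x])
  then obtain k where k: "\<And>a j. Z a j = of_bool (a = k j)" by metis
  have "\<exists>b. \<forall>l. Y l i = of_bool (l = b)" for i
    by (rule integral_sum_eq_1_imp_indicator)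
      (auto simp: Y_def sum.swap[of _ "UNIV :: 3 set" "UNIV :: 2 set"] satp_lp_sum_cell[OF x]
        intro!: int Ints_sum sum_nonneg satp_lp_nonneg[OF x])
  then obtain l where l: "\<And>b i. Y b i = of_bool (b = l i)" by metis
  have zero: "x $ (a, b, i, j) = 0" if "a \<noteq> k j \<or> b \<noteq> l i" for a b i j
  proof -
    have "x $ (a, b, i, j) \<le> Z a j" unfolding Z[of a j i]
      by (rule member_le_sum) (auto intro: satp_lp_nonneg[OF x])
    moreover have "x $ (a, b, i, j) \<le> Y b i" unfolding Y[of b i j]
      by (rule member_le_sum[of a UNIV "\<lambda>a. x $ (a, b, i, j)"]) (auto intro: satp_lp_nonneg[OF x])
    ultimately show ?thesis
      using that satp_lp_nonneg[OF x, of "(a, b, i, j)"] by (auto simp: k l)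
  qed
  have one: "x $ (k j, l i, i, j) = 1" for i j
  proof -
    have "Z (k j) j = (\<Sum>b\<in>UNIV. if b = l i then x $ (k j, l i, i, j) else 0)"
      unfolding Z[of "k j" j i] by (intro sum.cong) (auto simp: zero)
    then show ?thesis by (simp add: k)
  qed
  have "x = satp_point k l"
    by (auto simp: vec_eq_iff zero one)
  then show "x \<in> range (case_prod satp_point)" by auto
qed (auto simp: satp_point_in_satp_lp)

lemma satp_eq: "satp = convex hull (range (case_prod satp_point))"
  unfolding satp_def integral_satp_lp_eq ..

lemma satp_point_in_satp: "satp_point k l \<in> satp"
  unfolding satp_eq by (rule hull_inc) auto

lemma satp_subset_satp_lp: "satp \<subseteq> satp_lp"
  unfolding satp_eq
  by (intro hull_minimal) (auto simp: satp_point_in_satp_lp convex_satp_lp)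

section \<open>Segments between integral points as faces\<close>

text \<open>At an entry where the left-hand point is 1, an endpoint of positive weight must also be
  1, since both endpoints are 0/1 vectors. Hence it has the same labels.\<close>

lemma satp_point_in_segmentD:
  fixes k :: "'n::finite \<Rightarrow> 3" and l :: "'m::finite \<Rightarrow> 2"
  assumes "satp_point k l \<in> closed_segment (satp_point k1 l1) (satp_point k2 l2)"
  shows "k = k1 \<and> l = l1 \<or> k = k2 \<and> l = l2"
proof -
  obtain s where "0 \<le> s" "s \<le> 1"
    and eq: "satp_point k l = (1 - s) *\<^sub>R satp_point k1 l1 + s *\<^sub>R satp_point k2 l2"
    using assms by (auto simp: in_segment)
  have "(1 - s) * (if k j = k1 j \<and> l i = l1 i then 1 else 0)
      + s * (if k j = k2 j \<and> l i = l2 i then 1 else 0) = 1" for i j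
    using arg_cong[OF eq, of "\<lambda>x. x $ (k j, l i, i, j)"] by (simp add: of_bool_def)
  then have "s = 1 \<or> k j = k1 j \<and> l i = l1 i" "s = 0 \<or> k j = k2 j \<and> l i = l2 i" for i j
    by (auto dest!: meta_spec[of _ i] meta_spec[of _ j] split: if_splits)
  then show ?thesis by (cases "s = 1") (auto simp: fun_eq_iff)
qed

text \<open>Both pairs have the same midpoint, which lies in the face. If the first pair is
  distinct, the face property pulls its members into the segment; if not, its single point is that
  midpoint. Either way an integral point of the segment is an endpoint.\<close>

lemma satp_point_exchange:
  fixes k k' k1 k2 :: "'n::finite \<Rightarrow> 3" and l l' l1 l2 :: "'m::finite \<Rightarrow> 2"
  assumes "closed_segment (satp_point k l) (satp_point k' l') face_of satp"
    and "satp_point k1 l1 + satp_point k2 l2 = satp_point k l + satp_point k' l'"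
  shows "k1 = k \<and> l1 = l \<or> k1 = k' \<and> l1 = l'"
proof (cases "satp_point k1 l1 = satp_point k2 l2")
  case True
  then have "satp_point k1 l1 = midpoint (satp_point k l) (satp_point k' l')"
    using assms(2) midpoint_idem by (metis midpoint_def)
  then show ?thesis
    using satp_point_in_segmentD midpoint_in_closed_segment by metis
next
  case False
  have "midpoint (satp_point k1 l1) (satp_point k2 l2)
      \<in> closed_segment (satp_point k l) (satp_point k' l')"
    using assms(2) midpoint_in_closed_segment by (metis midpoint_def)
  moreover have "midpoint (satp_point k1 l1) (satp_point k2 l2)
      \<in> open_segment (satp_point k1 l1) (satp_point k2 l2)"
    using False by simp
  ultimately have "satp_point k1 l1 \<in> closed_segment (satp_point k l) (satp_point k' l')"
    using assms(1) satp_point_in_satp unfolding face_of_def by blast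
  then show ?thesis by (rule satp_point_in_segmentD)
qed

lemma face_of_satp_lp_zero:
  "{x \<in> satp_lp. \<forall>e\<in>E. x $ e = 0} face_of satp_lp"
proof -
  have face: "{x \<in> satp_lp. x $ e = 0} face_of satp_lp" for e :: "3 \<times> 2 \<times> 'a::finite \<times> 'b::finite"
  proof -
    have "satp_lp \<inter> {x :: ('a, 'b) satp_space. axis e 1 \<bullet> x = 0} face_of satp_lp"
      by (intro face_of_Int_supporting_hyperplane_ge)
        (auto simp: inner_axis' satp_lp_nonneg convex_satp_lp)
    then show ?thesis by (simp add: inner_axis' Int_def)
  qed
  show ?thesis
  \<comment> \<open>With no constraint the face is \<open>satp_lp\<close> itself, which is not an
    intersection over an empty family.\<close>
  proof (cases "E = {}")
    case True
    then show ?thesis by (simp add: face_of_refl convex_satp_lp)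
  next
    case False
    then have eq: "{x \<in> satp_lp. \<forall>e\<in>E. x $ e = 0} = \<Inter> ((\<lambda>e. {x \<in> satp_lp. x $ e = 0}) ` E)"
      by auto
    show ?thesis unfolding eq
      using False face
      by (intro face_of_Inter) auto
  qed
qed

text \<open>
  In the smallest face of \<open>satp_lp\<close> containing two integral points, the entries of \<open>x\<close> on a cell
  where the points differ are \<open>1 - t\<close> and \<open>t\<close>. In a column whose label changes, \<open>t\<close> is a column
  marginal, hence the same for all rows; in a row whose label changes, it is the same for all
  columns. Thus \<open>t\<close> can only take several values if all changes occur in rows, or all in columns,
  and at least two labels change; changing these one by one then shows that the segment is not
  a face of \<open>satp\<close>.
\<close>

lemma segment_face_of_satp_lp:
  fixes k k' :: "'n::finite \<Rightarrow> 3" and l l' :: "'m::finite \<Rightarrow> 2"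
  assumes face: "closed_segment (satp_point k l) (satp_point k' l') face_of satp"
  shows "closed_segment (satp_point k l) (satp_point k' l') face_of satp_lp"
proof -
  let ?u = "satp_point k l" and ?v = "satp_point k' l'"
  define F where "F = {x \<in> satp_lp. \<forall>e\<in>{e. ?u $ e = 0 \<and> ?v $ e = 0}. x $ e = 0}"
  have "F face_of satp_lp" unfolding F_def by (rule face_of_satp_lp_zero)
  moreover have "F = closed_segment ?u ?v"
  proof
    have "?u \<in> F" "?v \<in> F" by (auto simp: F_def satp_point_in_satp_lp)
    then show "closed_segment ?u ?v \<subseteq> F"
      using \<open>F face_of satp_lp\<close> by (intro closed_segment_subset) (auto simp: face_of_def)
    show "F \<subseteq> closed_segment ?u ?v"
    proof
      fix x assume "x \<in> F"
      then have x: "x \<in> satp_lp"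
        and zero: "\<And>a b i j. (a, b) \<notin> {(k j, l i), (k' j, l' i)} \<Longrightarrow> x $ (a, b, i, j) = 0"
        by (auto simp: F_def)
      define t where "t i j = x $ (k' j, l' i, i, j)" for i j
      have cell: "x $ (k j, l i, i, j) + t i j = 1" if "k j \<noteq> k' j \<or> l i \<noteq> l' i" for i j
      proof -
        have "(\<Sum>a\<in>UNIV. \<Sum>b\<in>UNIV. x $ (a, b, i, j))
            = (\<Sum>p\<in>UNIV. x $ (fst p, snd p, i, j))"
          by (simp add: sum.cartesian_product case_prod_unfold)
        also have "\<dots> = (\<Sum>p\<in>{(k j, l i), (k' j, l' i)}. x $ (fst p, snd p, i, j))"
          by (rule sum.mono_neutral_right) (auto intro: zero)
        also have "\<dots> = x $ (k j, l i, i, j) + t i j"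
          using that by (auto simp: t_def)
        finally show ?thesis using satp_lp_sum_cell[OF x] by simp
      qed
      have same: "x $ (k j, l i, i, j) = 1" if "k j = k' j" "l i = l' i" for i j
      proof -
        have "(\<Sum>a\<in>UNIV. \<Sum>b\<in>UNIV. x $ (a, b, i, j))
            = (\<Sum>p\<in>UNIV. x $ (fst p, snd p, i, j))"
          by (simp add: sum.cartesian_product case_prod_unfold)
        also have "\<dots> = (\<Sum>p\<in>{(k j, l i)}. x $ (fst p, snd p, i, j))"
          using that by (intro sum.mono_neutral_right) (auto intro: zero)
        finally show ?thesis using satp_lp_sum_cell[OF x] by simp
      qed
      \<comment> \<open>In a changing column the label \<open>k' j\<close> belongs to the second
        endpoint alone, so its marginal reduces to the single entry \<open>t i j\<close>.\<close>
      have col: "t i j = t s j" if "k j \<noteq> k' j" for i s j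
      proof -
        have "(\<Sum>b\<in>UNIV. x $ (k' j, b, i, j)) = t i j" for i
        proof -
          have "(\<Sum>b\<in>UNIV. x $ (k' j, b, i, j)) = (\<Sum>b\<in>{l' i}. x $ (k' j, b, i, j))"
            using that by (intro sum.mono_neutral_right) (auto intro: zero)
          then show ?thesis by (simp add: t_def)
        qed
        then show ?thesis using satp_lp_column[OF x] by metis
      qed
      have row: "t i j = t i s" if "l i \<noteq> l' i" for i j s
      proof -
        have "(\<Sum>a\<in>UNIV. x $ (a, l' i, i, j)) = t i j" for j
        proof -
          have "(\<Sum>a\<in>UNIV. x $ (a, l' i, i, j)) = (\<Sum>a\<in>{k' j}. x $ (a, l' i, i, j))"
            using that by (intro sum.mono_neutral_right) (auto intro: zero)
          then show ?thesis by (simp add: t_def)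
        qed
        then show ?thesis using satp_lp_row[OF x] by metis
      qed
      \<comment> \<open>Swap the label of column \<open>j\<close> only. The new first point differs
        from the first endpoint at \<open>j\<close>, so by exchange it is the second endpoint, and
        no other column can change.\<close>
      have cols: "j = j'" if "k j \<noteq> k' j" "k j' \<noteq> k' j'" "l = l'" for j j'
      proof -
        have "satp_point (k(j := k' j)) l + satp_point (k'(j := k j)) l = ?u + ?v"
          using \<open>l = l'\<close> by (auto simp: vec_eq_iff)
        then show ?thesis
          using satp_point_exchange[OF face] that by (metis fun_upd_apply)
      qed
      have rows: "i = i'" if "l i \<noteq> l' i" "l i' \<noteq> l' i'" "k = k'" for i i'
      proof -
        have "satp_point k (l(i := l' i)) + satp_point k (l'(i := l i)) = ?u + ?v"
          using \<open>k = k'\<close> by (auto simp: vec_eq_iff)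
        then show ?thesis
          using satp_point_exchange[OF face] that by (metis fun_upd_apply)
      qed
      have const: "t i j = t i' j'"
        if "k j \<noteq> k' j \<or> l i \<noteq> l' i" "k j' \<noteq> k' j' \<or> l i' \<noteq> l' i'" for i j i' j'
      proof (cases "l = l' \<or> k = k'")
        case True
        then show ?thesis using that col row cols rows by metis
      next
        case False
        \<comment> \<open>Every changing cell is linked to the cell (r, c): from a changing column
          along it to row r and then along r, from a changing row along it to column c and then
          along c.\<close>
        then obtain r c where "l r \<noteq> l' r" "k c \<noteq> k' c" by blast
        then have "t i j = t r c" if "k j \<noteq> k' j \<or> l i \<noteq> l' i" for i j
          using that col row by metis
        then show ?thesis using that by metis
      qed
      obtain T where T: "0 \<le> T" "T \<le> 1"
        "\<And>i j. k j \<noteq> k' j \<or> l i \<noteq> l' i \<Longrightarrow> t i j = T"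
      proof (cases "\<exists>i j. k j \<noteq> k' j \<or> l i \<noteq> l' i")
        case True
        then obtain i j where "k j \<noteq> k' j \<or> l i \<noteq> l' i" by blast
        then show ?thesis
          using that[of "t i j"] const satp_lp_nonneg[OF x] satp_lp_le_1[OF x]
          by (metis t_def)
      next
        case False
        \<comment> \<open>The endpoints coincide here, so any weight in [0, 1] would do.\<close>
        then show ?thesis using that[of 0] by auto
      qed
      have "x $ (a, b, i, j) = ((1 - T) *\<^sub>R ?u + T *\<^sub>R ?v) $ (a, b, i, j)" for a b i j
      proof (cases "k j \<noteq> k' j \<or> l i \<noteq> l' i")
        case True
        then show ?thesis
          using cell[OF True] T(3)[OF True] zero[of a b j i] by (auto simp: t_def)
      next
        case False
        then show ?thesis using same[of j i] zero[of a b j i] by auto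
      qed
      then have "x = (1 - T) *\<^sub>R ?u + T *\<^sub>R ?v" by (auto simp: vec_eq_iff)
      then show "x \<in> closed_segment ?u ?v" using T by (auto simp: in_segment)
    qed
  qed
  ultimately show ?thesis by simp
qed

text \<open>A face of a convex hull of finitely many points is the hull of some of them. Being
  compact, convex and collinear, it is a segment, and the ends of the segment are extreme, hence
  among these points.\<close>

lemma face_of_satp_low_dim:
  fixes F :: "('m::finite, 'n::finite) satp_space set"
  assumes face: "F face_of satp" and "F \<noteq> {}" "aff_dim F \<le> 1"
  obtains k l k' l' where "F = closed_segment (satp_point k l) (satp_point k' l')"
proof -
  obtain S where S: "S \<subseteq> range (case_prod satp_point)" "F = convex hull S"
    using face_of_convex_hull_subset[of "range (case_prod satp_point)" F] face
    unfolding satp_eq by (auto simp: finite_imp_compact)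
  have "compact F" "convex F"
    using S finite_subset[OF S(1)] by (auto simp: finite_imp_compact compact_convex_hull)
  moreover have "collinear F"
    using assms by (simp add: collinear_aff_dim)
  ultimately obtain a b where ab: "F = closed_segment a b"
    using compact_convex_collinear_segment[OF \<open>F \<noteq> {}\<close>] by blast
  have "a extreme_point_of F" "b extreme_point_of F"
    unfolding ab by (auto simp: extreme_point_of_segment)
  then have "a \<in> S" "b \<in> S"
    unfolding S(2) by (auto dest: extreme_point_of_convex_hull)
  then obtain k l k' l' where "a = satp_point k l" "b = satp_point k' l'"
    using subsetD[OF S(1)] by (metis case_prod_beta imageE)
  then show ?thesis using ab that by blast
qed

theorem theorem16:
  "trubin_property (satp_lp :: ('m::finite, 'n::finite) satp_space set) satp"
proof -
  \<comment> \<open>Vertices and edges are treated together, a vertex being a degenerate segment;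
    the dimension of F does not depend on the surrounding polytope.\<close>
  have face: "F face_of satp_lp" if F: "F face_of satp" "0 \<le> aff_dim F" "aff_dim F \<le> 1"
    for F :: "('m, 'n) satp_space set"
  proof -
    have "F \<noteq> {}" using F by auto
    then obtain k l k' l' where "F = closed_segment (satp_point k l) (satp_point k' l')"
      using face_of_satp_low_dim F by blast
    then show ?thesis using segment_face_of_satp_lp F by blast
  qed
  have "one_skeleton satp \<subseteq> one_skeleton (satp_lp :: ('m, 'n) satp_space set)"
  proof
    fix F :: "('m, 'n) satp_space set"
    assume "F \<in> one_skeleton satp"
    then show "F \<in> one_skeleton satp_lp"
      using face[of F] by (auto simp: one_skeleton_def edge_of_def)
  qed
  moreover have "polytope (satp :: ('m, 'n) satp_space set)"
    unfolding satp_eq by (simp add: polytope_convex_hull)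
  ultimately show ?thesis
    by (simp add: trubin_property_def polytope_satp_lp satp_subset_satp_lp)
qed

end
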